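(* Let $n$ be a fixed positive integer. Then $$\frac{p_{n}^{(k)}}{p_{k}^{(k)}}\longrightarrow 0\qquad\text{as } k\longrightarrow\infty.$$
   Context: $p_n$ denotes the $n$th prime number ($p_1=2$, $p_2=3$, ...). For positive integers $n,k$, define $p_n^{(k)}$ recursively by $p_n^{(1)}:=p_n$ and $p_n^{(k)}:=p_{p_n^{(k-1)}}$ for $k\ge 2$; that is, $p_n^{(k)}$ is the $p_n^{(k-1)}$th prime. *)

theory Defs
  imports Complex_Main "HOL-Computational_Algebra.Primes" "HOL-Library.Infinite_Set"
begin

(* The library function enumerate counts from 0, whereas p_1 = 2.
   The value at n = 0 carries no meaning. *)
definition nth_prime :: "nat \<Rightarrow> nat" where
  "nth_prime n = enumerate {p :: nat. prime p} (n - 1)"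

(* iter_prime k n is p_n^(k) for positive n and k; the recursion in the two lemmas
   below is the usual definition, and the value n at k = 0 is only a convention. *)
definition iter_prime :: "nat \<Rightarrow> nat \<Rightarrow> nat" where
  "iter_prime k n = (nth_prime ^^ k) n"

lemma iter_prime_1: "iter_prime 1 n = nth_prime n"
  by (simp add: iter_prime_def)

lemma iter_prime_rec: "k \<ge> 2 \<Longrightarrow> iter_prime k n = nth_prime (iter_prime (k - 1) n)"
  by (cases k) (simp_all add: iter_prime_def)

end

theory Submission
  imports Defs "HOL-Real_Asymp.Real_Asymp"
begin

text \<open>
  Write \<open>m\<close> for the \<open>k\<close>-th iterate starting at \<open>n\<close>. As soon as \<open>k \<ge> p_n\<close>, monotonicity gives
  \<open>p_k^(k) \<ge> p_n^(k+1) = p_m\<close>, so the quotient is at most \<open>m / p_m\<close>. Since \<open>m\<close> tends to infinity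
  with \<open>k\<close>, it suffices that \<open>m / p_m\<close> tends to 0, that is, that the primes have density zero.
  This follows from Chebyshev's argument: the primes in \<open>(N, 2N]\<close> all divide \<open>2N choose N \<le> 4^N\<close>.
\<close>

lemma prod_primes_dvd:
  fixes x :: nat
  assumes "finite A" "\<And>p. p \<in> A \<Longrightarrow> prime p" "\<And>p. p \<in> A \<Longrightarrow> p dvd x"
  shows "\<Prod>A dvd x"
  using assms
proof (induction A rule: finite_induct)
  case empty
  then show ?case by simp
next
  case (insert p A)
  have "coprime p (\<Prod>A)"
    by (rule prod_coprime_right) (use insert in \<open>metis insertCI primes_coprime\<close>)
  then show ?case
    using insert by (simp add: divides_mult)
qed

text \<open>Such a prime divides \<open>fact (2 * N)\<close> but not \<open>fact N\<close>, so it
  must survive in the quotient.\<close>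

lemma prime_dvd_central_binomial:
  assumes "prime p" "N < p" "p \<le> 2 * N"
  shows "p dvd (2 * N choose N)"
proof -
  have "p dvd fact N * fact N * (2 * N choose N)"
    using assms binomial_fact_lemma[of N "2 * N"] by (simp add: prime_dvd_fact_iff mult_2)
  then show ?thesis
    using assms by (simp add: prime_dvd_mult_iff prime_dvd_fact_iff)
qed

lemma power_card_primes_le: "N ^ card {p. prime p \<and> N < p \<and> p \<le> 2 * N} \<le> 2 ^ (2 * N)"
proof -
  let ?A = "{p. prime p \<and> N < p \<and> p \<le> 2 * N}"
  have fin: "finite ?A"
    by (rule finite_subset[of _ "{..2 * N}"]) auto
  have "N ^ card ?A = (\<Prod>p\<in>?A. N)"
    by simp
  also have "\<dots> \<le> \<Prod>?A"
    by (rule prod_mono) auto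
  also have "\<dots> \<le> (2 * N choose N)"
    by (intro dvd_imp_le prod_primes_dvd[OF fin]) (auto intro: prime_dvd_central_binomial)
  also have "\<dots> \<le> 2 ^ (2 * N)"
    by (rule binomial_le_pow2)
  finally show ?thesis .
qed

text \<open>Chebyshev's upper bound at powers of two, in division-free form. Passing from
  \<open>2 ^ j\<close> to \<open>2 ^ Suc j\<close> adds one dyadic block of primes, and the binomial
  estimate with \<open>N = 2 ^ j\<close> bounds that block.\<close>

lemma card_primes_le_power_two: "j * card {p::nat. prime p \<and> p \<le> 2 ^ j} \<le> 6 * 2 ^ j"
proof (induction j)
  case 0
  then show ?case by simp
next
  case (Suc j)
  let ?P = "\<lambda>j. {p::nat. prime p \<and> p \<le> 2 ^ j}"
  let ?B = "{p::nat. prime p \<and> 2 ^ j < p \<and> p \<le> 2 * 2 ^ j}"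
  have "?P (Suc j) = ?P j \<union> ?B"
    by auto
  then have split: "card (?P (Suc j)) \<le> card (?P j) + card ?B"
    by (metis card_Un_le)
  have "(2::nat) ^ (j * card ?B) \<le> 2 ^ (2 * 2 ^ j)"
    using power_card_primes_le[of "2 ^ j"] by (simp add: power_mult)
  then have new: "j * card ?B \<le> 2 * 2 ^ j"
    by (simp only: power_increasing_iff)
  show ?case
  \<comment> \<open>The general step needs \<open>8 * Suc j \<le> 12 * j\<close>, which holds
    exactly from \<open>j = 2\<close> on. Below that, counting all positive integers up to
    \<open>2 ^ Suc j\<close> is enough.\<close>
  proof (cases "j < 2")
    case True
    have "card (?P (Suc j)) \<le> card {1::nat..2 ^ Suc j}"
      by (rule card_mono) (auto dest: prime_gt_0_nat)
    then have "Suc j * card (?P (Suc j)) \<le> Suc j * 2 ^ Suc j"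
      by (simp only: card_atLeastAtMost mult_le_mono2 diff_Suc_1)
    also have "\<dots> \<le> 6 * 2 ^ Suc j"
      using True by (intro mult_le_mono1) simp
    finally show ?thesis .
  next
    case False
    \<comment> \<open>The extra factor \<open>j\<close> lets the induction hypothesis and
      \<open>new\<close> both apply; they contribute 6 and 2 to the constant 8. It is cancelled at
      the end.\<close>
    have "j * (Suc j * card (?P (Suc j))) \<le> Suc j * (j * card (?P j) + j * card ?B)"
      using mult_le_mono2[OF split, of "j * Suc j"] by (simp add: algebra_simps)
    also have "\<dots> \<le> Suc j * (8 * 2 ^ j)"
      using Suc.IH new by (intro mult_le_mono2) simp
    also have "\<dots> = (8 * Suc j) * 2 ^ j"
      by (simp only: ac_simps)
    also have "\<dots> \<le> (12 * j) * 2 ^ j"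
      using False by (intro mult_le_mono1) simp
    also have "\<dots> = j * (6 * 2 ^ Suc j)"
      by simp
    finally show ?thesis
      using False by (simp only: mult_le_cancel1)
  qed
qed

lemma le_card_primes_nth_prime: "m \<le> card {p. prime p \<and> p \<le> nth_prime m}"
proof -
  have "enumerate {p::nat. prime p} ` {..<m} \<subseteq> {p. prime p \<and> p \<le> nth_prime m}"
    using enumerate_in_set[OF primes_infinite] by (auto simp: nth_prime_def primes_infinite)
  moreover have "inj_on (enumerate {p::nat. prime p}) {..<m}"
    using inj_enumerate[OF primes_infinite] by (rule inj_on_subset) simp
  ultimately have "card {..<m} \<le> card {p. prime p \<and> p \<le> nth_prime m}"
    by (intro card_inj_on_le) auto
  then show ?thesis
    by simp
qed

lemma mono_nth_prime: "mono nth_prime"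
  by (rule monoI) (simp add: nth_prime_def primes_infinite diff_le_mono)

lemma less_nth_prime: "m < nth_prime m"
proof -
  \<comment> \<open>The enumeration starts at 2 and is strictly increasing. Taking
    \<open>i = m - 1\<close> also covers \<open>m = 0\<close>, where truncated subtraction gives the
    value 2.\<close>
  have "i + 2 \<le> enumerate {p::nat. prime p} i" for i
  proof (induction i)
    case 0
    then show ?case
      using prime_ge_2_nat[of "enumerate {p. prime p} 0"] enumerate_in_set[OF primes_infinite, of 0]
      by (simp del: enumerate_0)
  next
    case (Suc i)
    then show ?case
      using enumerate_step[OF primes_infinite, of i] by linarith
  qed
  from this[of "m - 1"] show ?thesis
    by (simp add: nth_prime_def)
qed

text \<open>The prime count is known only at powers of two, so it is applied at the first power
  above \<open>nth_prime m\<close>. This overshoots by a factor of at most 2, which turns 6 into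
  12.\<close>

lemma index_div_nth_prime_le:
  assumes "m \<ge> 2"
  shows "real m / real (nth_prime m) \<le> 12 / log 2 (real m)"
proof -
  let ?q = "nth_prime m"
  have q: "m < ?q"
    by (rule less_nth_prime)
  obtain i where i: "2 ^ i \<le> ?q" "?q < 2 ^ (i + 1)"
    using ex_power_ivl1[of 2 ?q] q by auto
  have "m \<le> card {p::nat. prime p \<and> p \<le> 2 ^ (i + 1)}"
    using le_card_primes_nth_prime[of m]
    by (rule order_trans) (use i in \<open>auto intro!: card_mono\<close>)
  then have "(i + 1) * m \<le> 6 * 2 ^ (i + 1)"
    using card_primes_le_power_two[of "i + 1"] mult_le_mono2 order_trans by blast
  also have "\<dots> \<le> 12 * ?q"
    using i by simp
  finally have bound: "real (i + 1) * real m \<le> 12 * real ?q"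
    by (metis of_nat_le_iff of_nat_mult of_nat_numeral)
  \<comment> \<open>Since \<open>m < ?q < 2 ^ (i + 1)\<close>, the exponent \<open>i + 1\<close> can
    be replaced by the smaller \<open>log 2 m\<close>.\<close>
  have "real m \<le> 2 ^ (i + 1)"
    using i q by (metis less_imp_le less_trans of_nat_le_iff of_nat_numeral of_nat_power)
  then have "real m \<le> 2 powr real (i + 1)"
    by (subst powr_realpow) simp_all
  then have "log 2 (real m) \<le> real (i + 1)"
    using assms by (simp add: log_le_iff)
  then have "log 2 (real m) * real m \<le> 12 * real ?q"
    using bound by (meson mult_right_mono of_nat_0_le_iff order_trans)
  then show ?thesis
    using assms q by (simp add: field_simps)
qed

lemma index_div_nth_prime_tendsto_0: "(\<lambda>m. real m / real (nth_prime m)) \<longlonglongrightarrow> 0"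
proof (rule tendsto_sandwich[of "\<lambda>_. 0"])
  show "\<forall>\<^sub>F m in sequentially. real m / real (nth_prime m) \<le> 12 / log 2 (real m)"
    using index_div_nth_prime_le by (auto intro: eventually_sequentiallyI)
  show "(\<lambda>m. 12 / log 2 (real m)) \<longlonglongrightarrow> 0"
    by real_asymp
qed auto

lemma iter_prime_Suc: "iter_prime (Suc k) n = nth_prime (iter_prime k n)"
  by (simp add: iter_prime_def)

text \<open>Each application of \<open>nth_prime\<close> raises the value by at least 1. This forces
  the iterates to infinity.\<close>

lemma le_iter_prime: "k \<le> iter_prime k n"
proof (induction k)
  case (Suc k)
  then show ?case
    using less_nth_prime[of "iter_prime k n"] by (simp add: iter_prime_Suc)
qed simp

lemma nth_prime_iter_prime_le:
  assumes "nth_prime n \<le> k"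
  shows "nth_prime (iter_prime k n) \<le> iter_prime k k"
proof -
  \<comment> \<open>The outermost application moves to the inside, so that both sides become
    \<open>k\<close>-fold iterates and only their starting points need comparing.\<close>
  have "nth_prime (iter_prime k n) = iter_prime k (nth_prime n)"
    by (simp add: iter_prime_def funpow_swap1)
  also have "\<dots> \<le> iter_prime k k"
    using funpow_mono[OF mono_nth_prime assms] by (simp add: iter_prime_def)
  finally show ?thesis .
qed

theorem proposition1p1:
  fixes n :: nat
  assumes "n \<ge> 1"
  shows "(\<lambda>k. real (iter_prime k n) / real (iter_prime k k)) \<longlonglongrightarrow> 0"
proof (rule tendsto_sandwich[of "\<lambda>_. 0"])
  let ?r = "\<lambda>k. iter_prime k n"
  have "real (?r k) / real (iter_prime k k) \<le> real (?r k) / real (nth_prime (?r k))"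
    if "nth_prime n \<le> k" for k
    using nth_prime_iter_prime_le[OF that] less_nth_prime[of "?r k"]
    by (intro divide_left_mono) auto
  then show "\<forall>\<^sub>F k in sequentially.
      real (?r k) / real (iter_prime k k) \<le> real (?r k) / real (nth_prime (?r k))"
    by (rule eventually_sequentiallyI)
  have "filterlim ?r sequentially sequentially"
    by (rule filterlim_at_top_mono[OF filterlim_ident]) (simp add: le_iter_prime)
  then show "(\<lambda>k. real (?r k) / real (nth_prime (?r k))) \<longlonglongrightarrow> 0"
    by (rule filterlim_compose[OF index_div_nth_prime_tendsto_0])
qed auto

end
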